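(* Let $T$ be a tournament with a transmitter $s$ and no receiver. Then $T$ is quadrangular if and only if $\gamma(T-s)>2$, $T-s$ is out-quadrangular, and $\delta^{+}(T-s)\geq 2$.
   Context: A tournament $T$ is a loopless digraph in which for each pair of distinct vertices $u\neq v$ exactly one of $(u,v)$, $(v,u)$ is an arc; $u\rightarrow v$ means $(u,v)$ is an arc. $O(v)=\{u:v\rightarrow u\}$, $I(v)=\{u:u\rightarrow v\}$. A digraph is quadrangular if for all distinct vertices $u,v$, $|O(u)\cap O(v)|\neq 1$ and $|I(u)\cap I(v)|\neq 1$; it is out-quadrangular if $|O(u)\cap O(v)|\neq1$ for all distinct $u,v$. A transmitter dominates all other vertices; a receiver is dominated by all other vertices. $T-s$ is the subtournament induced on $V(T)\setminus\{s\}$. $\delta^{+}(D)$ is the minimum out-degree $|O(v)|$ over vertices of $D$. A dominating set of $D$ is a set $S$ of vertices such that every vertex is in $S$ or dominated by some vertex in $S$; $\gamma(D)$ is the minimum size of a dominating set. *)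

theory Defs
  imports "Graph_Theory.Graph_Theory"
begin

text \<open>The library locale \<^locale>\<open>digraph\<close> means: finite, without loops and without
  parallel arcs.\<close>

locale tournament = digraph +
  assumes exactly_one_arc:
    "\<lbrakk>u \<in> verts G; v \<in> verts G; u \<noteq> v\<rbrakk> \<Longrightarrow> (u \<rightarrow>\<^bsub>G\<^esub> v) \<longleftrightarrow> \<not> (v \<rightarrow>\<^bsub>G\<^esub> u)"

definition out_set :: "('a, 'b) pre_digraph \<Rightarrow> 'a \<Rightarrow> 'a set" where
  "out_set D v = {u. v \<rightarrow>\<^bsub>D\<^esub> u}"

definition in_set :: "('a, 'b) pre_digraph \<Rightarrow> 'a \<Rightarrow> 'a set" where
  "in_set D v = {u. u \<rightarrow>\<^bsub>D\<^esub> v}"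

definition out_quadrangular :: "('a, 'b) pre_digraph \<Rightarrow> bool" where
  "out_quadrangular D \<longleftrightarrow>
    (\<forall>u \<in> verts D. \<forall>v \<in> verts D. u \<noteq> v \<longrightarrow> card (out_set D u \<inter> out_set D v) \<noteq> 1)"

definition quadrangular :: "('a, 'b) pre_digraph \<Rightarrow> bool" where
  "quadrangular D \<longleftrightarrow>
    (\<forall>u \<in> verts D. \<forall>v \<in> verts D. u \<noteq> v \<longrightarrow>
      card (out_set D u \<inter> out_set D v) \<noteq> 1 \<and> card (in_set D u \<inter> in_set D v) \<noteq> 1)"

definition transmitter :: "('a, 'b) pre_digraph \<Rightarrow> 'a \<Rightarrow> bool" where
  "transmitter D s \<longleftrightarrow> s \<in> verts D \<and> (\<forall>v \<in> verts D - {s}. s \<rightarrow>\<^bsub>D\<^esub> v)"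

definition receiver :: "('a, 'b) pre_digraph \<Rightarrow> 'a \<Rightarrow> bool" where
  "receiver D t \<longleftrightarrow> t \<in> verts D \<and> (\<forall>v \<in> verts D - {t}. v \<rightarrow>\<^bsub>D\<^esub> t)"

text \<open>Meaningful for finite digraphs with at least one vertex, since \<^const>\<open>Min\<close> is
  unspecified on the empty set.\<close>

definition min_out_degree :: "('a, 'b) pre_digraph \<Rightarrow> nat" where
  "min_out_degree D = Min ((\<lambda>v. card (out_set D v)) ` verts D)"

definition dominating_set :: "('a, 'b) pre_digraph \<Rightarrow> 'a set \<Rightarrow> bool" where
  "dominating_set D S \<longleftrightarrow>
    S \<subseteq> verts D \<and> (\<forall>v \<in> verts D. v \<in> S \<or> (\<exists>u \<in> S. u \<rightarrow>\<^bsub>D\<^esub> v))"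

definition domination_number :: "('a, 'b) pre_digraph \<Rightarrow> nat" where
  "domination_number D = Min (card ` {S. dominating_set D S})"

definition delete_vertex :: "('a, 'b) pre_digraph \<Rightarrow> 'a \<Rightarrow> ('a, 'b) pre_digraph" where
  "delete_vertex D s = D \<restriction> (verts D - {s})"

end

theory Submission
  imports Defs
begin

text \<open>The common in-neighbours in \<open>T\<close> of two vertices other than \<open>s\<close> are \<open>s\<close> together with their
  common in-neighbours in \<open>T - s\<close>. So there is exactly one of them iff no vertex of \<open>T - s\<close>
  dominates both, i.e. iff the pair is a dominating set of \<open>T - s\<close>. Likewise
  \<open>O(s) \<inter> O(v)\<close> is the out-set of \<open>v\<close> in \<open>T - s\<close>, and that is never empty as there is no
  receiver.\<close>

lemma verts_delete_vertex [simp]: "verts (delete_vertex D s) = verts D - {s}"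
  by (simp add: delete_vertex_def)

text \<open>Well-formedness places both ends of every arc in \<open>verts G\<close>, so an arc
  survives the deletion as soon as it avoids \<open>s\<close>.\<close>

lemma (in wf_digraph) dominates_delete_vertex:
  "u \<rightarrow>\<^bsub>delete_vertex G s\<^esub> v \<longleftrightarrow> u \<noteq> s \<and> v \<noteq> s \<and> u \<rightarrow>\<^bsub>G\<^esub> v"
  unfolding delete_vertex_def arcs_ends_def arc_to_ends_def induce_subgraph_def
  by (auto simp: image_iff)

context tournament
begin

lemma tournament_delete_vertex: "tournament (delete_vertex G s)"
proof -
  interpret D: digraph "delete_vertex G s"
    unfolding delete_vertex_def by (intro digraphI_induced induced_induce) auto
  show ?thesis
    by unfold_locales (auto simp: dominates_delete_vertex dest: exactly_one_arc)
qed

lemma finite_out_set: "finite (out_set G v)"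
  by (rule finite_subset[of _ "verts G"]) (auto simp: out_set_def)

lemma finite_in_set: "finite (in_set G v)"
  by (rule finite_subset[of _ "verts G"]) (auto simp: in_set_def)

text \<open>If no arc leaves \<open>v\<close>, each arc at \<open>v\<close> must enter it. A lone
  vertex counts as a receiver.\<close>

lemma out_set_eq_empty_iff_receiver:
  assumes "v \<in> verts G"
  shows "out_set G v = {} \<longleftrightarrow> receiver G v"
proof -
  have "out_set G v = {} \<longleftrightarrow> (\<forall>w \<in> verts G - {v}. \<not> v \<rightarrow>\<^bsub>G\<^esub> w)"
    using adj_not_same adj_in_verts(2) by (fastforce simp: out_set_def)
  also have "\<dots> \<longleftrightarrow> (\<forall>w \<in> verts G - {v}. w \<rightarrow>\<^bsub>G\<^esub> v)"
    using assms exactly_one_arc by (metis DiffE singletonI)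
  finally show ?thesis
    using assms by (simp add: receiver_def)
qed

lemma min_out_degree_ge_iff:
  assumes "verts G \<noteq> {}"
  shows "min_out_degree G \<ge> k \<longleftrightarrow> (\<forall>v \<in> verts G. card (out_set G v) \<ge> k)"
  unfolding min_out_degree_def using assms by simp

lemma domination_number_gt_iff:
  "domination_number G > k \<longleftrightarrow> (\<forall>S. dominating_set G S \<longrightarrow> card S > k)"
proof -
  have "finite {S. dominating_set G S}"
    by (rule finite_subset[of _ "Pow (verts G)"]) (auto simp: dominating_set_def)
  \<comment> \<open>A witness that the family under \<open>Min\<close> is nonempty.\<close>
  moreover have "dominating_set G (verts G)"
    by (auto simp: dominating_set_def)
  ultimately show ?thesis
    unfolding domination_number_def by (subst Min_gr_iff) auto
qed

text \<open>A vertex outside the pair that neither member dominates must itself dominate both.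
  Conversely, a common in-neighbour is outside the pair, since there are no loops and no
  2-cycles.\<close>

lemma dominating_pair_iff:
  assumes "u \<in> verts G" "v \<in> verts G"
  shows "dominating_set G {u, v} \<longleftrightarrow> in_set G u \<inter> in_set G v = {}"
proof -
  have "dominating_set G {u, v} \<longleftrightarrow>
      (\<forall>w \<in> verts G. w = u \<or> w = v \<or> u \<rightarrow>\<^bsub>G\<^esub> w \<or> v \<rightarrow>\<^bsub>G\<^esub> w)"
    using assms by (auto simp: dominating_set_def)
  also have "\<dots> \<longleftrightarrow> (\<forall>w \<in> verts G. \<not> (w \<rightarrow>\<^bsub>G\<^esub> u \<and> w \<rightarrow>\<^bsub>G\<^esub> v))"
    using assms exactly_one_arc adj_not_same by metis
  also have "\<dots> \<longleftrightarrow> in_set G u \<inter> in_set G v = {}"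
    using adj_in_verts(1) by (auto simp: in_set_def)
  finally show ?thesis .
qed

text \<open>A superset of a dominating set dominates, so only pairs of distinct vertices need
  testing. With a single vertex the right side would be vacuous although the domination number is
  1.\<close>

lemma domination_number_gt_2_iff:
  assumes "card (verts G) \<ge> 2"
  shows "domination_number G > 2 \<longleftrightarrow>
    (\<forall>u \<in> verts G. \<forall>v \<in> verts G. u \<noteq> v \<longrightarrow> in_set G u \<inter> in_set G v \<noteq> {})"
proof
  assume "domination_number G > 2"
  then have "\<not> dominating_set G {u, v}" if "u \<noteq> v" for u v
    using that by (force simp: domination_number_gt_iff)
  then show "\<forall>u \<in> verts G. \<forall>v \<in> verts G. u \<noteq> v \<longrightarrow> in_set G u \<inter> in_set G v \<noteq> {}"
    using dominating_pair_iff by blast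
next
  assume common: "\<forall>u \<in> verts G. \<forall>v \<in> verts G. u \<noteq> v \<longrightarrow> in_set G u \<inter> in_set G v \<noteq> {}"
  have "card S > 2" if S: "dominating_set G S" for S
  proof (rule ccontr)
    assume "\<not> card S > 2"
    moreover have "S \<subseteq> verts G"
      using S by (simp add: dominating_set_def)
    \<comment> \<open>A set of fewer than two vertices is padded to a pair.\<close>
    ultimately obtain P where P: "S \<subseteq> P" "P \<subseteq> verts G" "card P = 2"
      using exists_subset_between[of S 2 "verts G"] assms by auto
    then obtain u v where uv: "P = {u, v}" "u \<noteq> v"
      by (auto simp: card_2_iff)
    have "dominating_set G {u, v}"
      using S P uv unfolding dominating_set_def by blast
    then show False
      using dominating_pair_iff common P uv by auto
  qed
  then show "domination_number G > 2"
    by (simp add: domination_number_gt_iff)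
qed

text \<open>The pairs are split by whether they contain \<open>s\<close>. Receivers are still
  allowed here, so an out-degree in \<open>T - s\<close> may be 0 and the condition reads \<noteq>
  1.\<close>

lemma quadrangular_iff_if_transmitter:
  assumes s: "transmitter G s"
  shows "quadrangular G \<longleftrightarrow>
    out_quadrangular (delete_vertex G s) \<and>
    (\<forall>v \<in> verts G - {s}. card (out_set (delete_vertex G s) v) \<noteq> 1) \<and>
    (\<forall>u \<in> verts G - {s}. \<forall>v \<in> verts G - {s}. u \<noteq> v \<longrightarrow>
      in_set (delete_vertex G s) u \<inter> in_set (delete_vertex G s) v \<noteq> {})"
proof -
  let ?D = "delete_vertex G s"
  interpret D: tournament ?D
    by (rule tournament_delete_vertex)
  have s_dom: "s \<rightarrow>\<^bsub>G\<^esub> v" "\<not> v \<rightarrow>\<^bsub>G\<^esub> s" if "v \<in> verts G - {s}" for v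
    using s that exactly_one_arc by (auto simp: transmitter_def)
  have in_s: "in_set G s = {}"
    using s_dom adj_not_same by (force simp: in_set_def)
  have out_s: "out_set G s = verts G - {s}"
    using s_dom adj_not_same by (force simp: out_set_def)
  have out_D: "out_set ?D v = out_set G v" if "v \<in> verts G - {s}" for v
    using that s_dom by (auto simp: out_set_def dominates_delete_vertex)
  have out_sv: "out_set G s \<inter> out_set G v = out_set ?D v"
    if "v \<in> verts G - {s}" for v
    using that s_dom out_D[OF that] out_s by (auto simp: out_set_def)
  have "in_set G v = insert s (in_set ?D v)" if "v \<in> verts G - {s}" for v
    using that s_dom by (auto simp: in_set_def dominates_delete_vertex)
  moreover have "s \<notin> in_set ?D v" for v
    by (simp add: in_set_def dominates_delete_vertex)
  ultimately have in_D: "card (in_set G u \<inter> in_set G v) = Suc (card (in_set ?D u \<inter> in_set ?D v))"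
    if "u \<in> verts G - {s}" "v \<in> verts G - {s}" for u v
    using that D.finite_in_set by simp
  have pair: "card (in_set G u \<inter> in_set G v) \<noteq> 1 \<longleftrightarrow> in_set ?D u \<inter> in_set ?D v \<noteq> {}"
    if "u \<in> verts G - {s}" "v \<in> verts G - {s}" for u v
    using in_D[OF that] D.finite_in_set by simp
  have V: "verts G = insert s (verts G - {s})"
    using s by (auto simp: transmitter_def)
  \<comment> \<open>For a pair containing \<open>s\<close> the in-set condition is automatic:
    nothing dominates \<open>s\<close>, so the intersection has cardinality 0.\<close>
  have "quadrangular G \<longleftrightarrow>
    (\<forall>v \<in> verts G - {s}. card (out_set G s \<inter> out_set G v) \<noteq> 1) \<and>
    (\<forall>u \<in> verts G - {s}. \<forall>v \<in> verts G - {s}. u \<noteq> v \<longrightarrow>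
      card (out_set G u \<inter> out_set G v) \<noteq> 1 \<and> card (in_set G u \<inter> in_set G v) \<noteq> 1)"
    unfolding quadrangular_def
    using V in_s by (metis Diff_iff Int_commute Int_empty_left card.empty insertE insertI1 zero_neq_one)
  also have "\<dots> \<longleftrightarrow> (\<forall>v \<in> verts G - {s}. card (out_set ?D v) \<noteq> 1) \<and>
    (\<forall>u \<in> verts G - {s}. \<forall>v \<in> verts G - {s}. u \<noteq> v \<longrightarrow>
      card (out_set ?D u \<inter> out_set ?D v) \<noteq> 1 \<and> in_set ?D u \<inter> in_set ?D v \<noteq> {})"
    by (simp only: out_sv out_D pair cong: ball_cong)
  finally show ?thesis
    unfolding out_quadrangular_def verts_delete_vertex by blast
qed

end

theorem theorem2:
  fixes T :: "('a, 'b) pre_digraph" and s :: 'a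
  assumes "tournament T"
    and "transmitter T s"
    and "\<not> (\<exists>t. receiver T t)"
  shows "quadrangular T \<longleftrightarrow>
    domination_number (delete_vertex T s) > 2 \<and>
    out_quadrangular (delete_vertex T s) \<and>
    min_out_degree (delete_vertex T s) \<ge> 2"
proof -
  let ?D = "delete_vertex T s"
  interpret tournament T by fact
  interpret D: tournament ?D
    by (rule tournament_delete_vertex)
  have s: "s \<in> verts T" "\<And>v. v \<in> verts T \<Longrightarrow> v \<noteq> s \<Longrightarrow> s \<rightarrow>\<^bsub>T\<^esub> v"
    using assms(2) by (auto simp: transmitter_def)
  \<comment> \<open>As \<open>s\<close> also dominates \<open>v\<close>, a receiver of
    \<open>T - s\<close> would be one of \<open>T\<close>.\<close>
  have "\<not> receiver ?D v" if "v \<in> verts ?D" for v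
    using assms(3) that s by (force simp: receiver_def dominates_delete_vertex)
  then have out_ne: "out_set ?D v \<noteq> {}" if "v \<in> verts ?D" for v
    using that D.out_set_eq_empty_iff_receiver by blast
  then have out_pos: "card (out_set ?D v) > 0" if "v \<in> verts ?D" for v
    using that D.finite_out_set by (simp add: card_gt_0_iff)
  \<comment> \<open>If \<open>s\<close> were the only vertex, it would be a receiver vacuously. An
    out-neighbour of \<open>v\<close> then supplies the second vertex.\<close>
  obtain v where v: "v \<in> verts ?D"
    using assms(3) s(1) by (auto simp: receiver_def)
  then obtain w where w: "v \<rightarrow>\<^bsub>?D\<^esub> w"
    using out_ne by (auto simp: out_set_def)
  then have "{v, w} \<subseteq> verts ?D" "v \<noteq> w"
    using D.adj_in_verts D.adj_not_same by auto
  then have "card (verts ?D) \<ge> 2"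
    using card_mono[OF D.finite_verts] by (metis card_2_iff)
  note gamma = D.domination_number_gt_2_iff[OF this]
  \<comment> \<open>With out-degree 0 excluded, avoiding 1 means being at least 2.\<close>
  have "card (out_set ?D v) \<ge> 2 \<longleftrightarrow> card (out_set ?D v) \<noteq> 1" if "v \<in> verts ?D" for v
    using out_pos[OF that] by linarith
  then have "min_out_degree ?D \<ge> 2 \<longleftrightarrow> (\<forall>v \<in> verts ?D. card (out_set ?D v) \<noteq> 1)"
    using v D.min_out_degree_ge_iff by blast
  then show ?thesis
    using quadrangular_iff_if_transmitter[OF assms(2)] gamma verts_delete_vertex[of T s] by metis
qed

end
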